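(* Let $\Omega=\mathbb{R}^d$ with Borel $\sigma$-algebra and Lebesgue measure $m$. The Hölder divergence is affine invariant. More precisely, let $\sigma\in\mathbb{R}^{d\times d}$ be any invertible matrix and $\mu\in\mathbb{R}^d$ any vector. For $\gamma>0$ and the Hölder divergence $D$ with parameter $\gamma$ and function $\phi$, one has $D(p_{\sigma,\mu},q_{\sigma,\mu})=|\det\sigma|^\gamma D(p,q)$ for all probability densities $p,q\in L_{1+\gamma}^+$, so that $D$ is affine invariant with scale function $h(\sigma,\mu)=|\det\sigma|^{-\gamma}$. For $\gamma=0$ (the Kullback–Leibler divergence $D$), one has $D(p_{\sigma,\mu},q_{\sigma,\mu})=D(p,q)$ for all probability densities $p,q\in\mathcal{F}$, so that $D$ is affine invariant with scale function $h(\sigma,\mu)=1$.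
   Context: Notation: $\mathbb{R}_+=[0,\infty)$; $\langle f\rangle=\int_\Omega f\,dm$; for $\alpha\ge1$, $L_\alpha^+$ is the set of non-negative, non-zero measurable functions $f$ on $\Omega$ with $\langle f^\alpha\rangle<\infty$. For a probability density $p$, $p_{\sigma,\mu}(\omega)=|\det\sigma|\,p(\sigma\omega+\mu)$. Hölder score with $\gamma>0$: for $\phi:\mathbb{R}_+\to\mathbb{R}$ with $\phi(1)=-1$ and $\phi(z)\ge-z^{1+\gamma}$ for all $z\ge0$, $S(f,g)=\phi\big(\langle fg^\gamma\rangle/\langle g^{1+\gamma}\rangle\big)\langle g^{1+\gamma}\rangle$ for $f,g\in\mathcal{F}=L_{1+\gamma}^+$. Hölder score with $\gamma=0$: $S(f,g)=\langle-f\log g+g\rangle$ for $f,g\in\mathcal{F}$, where $\mathcal{F}\subset L_1^+$ is such that $f\log g$ is integrable for all $f,g\in\mathcal{F}$ (conventions $\log0=-\infty$, $0\cdot\infty=0$). The Hölder divergence is $D(f,g)=S(f,g)-S(f,f)$. A divergence $D$ is affine invariant with scale function $h$ if $h(\sigma,\mu)>0$ and $h(\sigma,\mu)D(p_{\sigma,\mu},q_{\sigma,\mu})=D(p,q)$ for all probability densities $p,q\in\mathcal{F}$, all invertible $\sigma\in\mathbb{R}^{d\times d}$ and all $\mu\in\mathbb{R}^d$, where $D(p_{\sigma,\mu},q_{\sigma,\mu})$ is evaluated by the formula defining $S$. *)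

theory Defs
  imports "HOL-Analysis.Analysis"
begin

(* Non-zero means non-zero as a measurable function, i.e. not almost everywhere zero, so that the
   denominator in holder_score below does not vanish. For measurable f >= 0, integrability of
   f powr a is the same as finiteness of its integral. *)
definition L_plus :: "'a measure \<Rightarrow> real \<Rightarrow> ('a \<Rightarrow> real) set" where
  "L_plus M \<alpha> = {f \<in> borel_measurable M.
     (\<forall>x\<in>space M. 0 \<le> f x) \<and> \<not> (AE x in M. f x = 0) \<and> integrable M (\<lambda>x. f x powr \<alpha>)}"

definition prob_density :: "'a measure \<Rightarrow> ('a \<Rightarrow> real) \<Rightarrow> bool" where
  "prob_density M p \<longleftrightarrow> p \<in> borel_measurable M \<and> (\<forall>x\<in>space M. 0 \<le> p x) \<and>
     (\<integral>\<^sup>+x. ennreal (p x) \<partial>M) = 1"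

(* The domain of the function is the half-line [0, infinity); its values elsewhere play no role. *)
definition holder_function :: "real \<Rightarrow> (real \<Rightarrow> real) \<Rightarrow> bool" where
  "holder_function \<gamma> \<phi> \<longleftrightarrow> \<phi> 1 = -1 \<and> (\<forall>z\<ge>0. \<phi> z \<ge> - (z powr (1 + \<gamma>)))"

definition holder_score ::
  "'a measure \<Rightarrow> real \<Rightarrow> (real \<Rightarrow> real) \<Rightarrow> ('a \<Rightarrow> real) \<Rightarrow> ('a \<Rightarrow> real) \<Rightarrow> real" where
  "holder_score M \<gamma> \<phi> f g =
     \<phi> ((\<integral>x. f x * g x powr \<gamma> \<partial>M) / (\<integral>x. g x powr (1 + \<gamma>) \<partial>M)) * (\<integral>x. g x powr (1 + \<gamma>) \<partial>M)"

(* For parameter 0 the logarithm takes the value -infinity at 0, so the integrands are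
   extended-real valued. HOL-Analysis has no integral for such functions, hence the standard one
   via positive and negative parts (e2ennreal sends negative arguments to 0). In ereal,
   0 * infinity = 0. *)
definition ext_integrable :: "'a measure \<Rightarrow> ('a \<Rightarrow> ereal) \<Rightarrow> bool" where
  "ext_integrable M u \<longleftrightarrow> u \<in> borel_measurable M \<and>
     (\<integral>\<^sup>+x. e2ennreal (u x) \<partial>M) < \<infinity> \<and> (\<integral>\<^sup>+x. e2ennreal (- u x) \<partial>M) < \<infinity>"

definition ext_integral :: "'a measure \<Rightarrow> ('a \<Rightarrow> ereal) \<Rightarrow> real" where
  "ext_integral M u =
     enn2real (\<integral>\<^sup>+x. e2ennreal (u x) \<partial>M) - enn2real (\<integral>\<^sup>+x. e2ennreal (- u x) \<partial>M)"

definition ext_ln :: "real \<Rightarrow> ereal" where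
  "ext_ln t = (if t > 0 then ereal (ln t) else - \<infinity>)"

definition KL_domain :: "'a measure \<Rightarrow> ('a \<Rightarrow> real) set \<Rightarrow> bool" where
  "KL_domain M F \<longleftrightarrow> F \<subseteq> L_plus M 1 \<and>
     (\<forall>f\<in>F. \<forall>g\<in>F. ext_integrable M (\<lambda>x. ereal (f x) * ext_ln (g x)))"

definition KL_score :: "'a measure \<Rightarrow> ('a \<Rightarrow> real) \<Rightarrow> ('a \<Rightarrow> real) \<Rightarrow> real" where
  "KL_score M f g = ext_integral M (\<lambda>x. - (ereal (f x) * ext_ln (g x)) + ereal (g x))"

definition divergence :: "('f \<Rightarrow> 'f \<Rightarrow> real) \<Rightarrow> 'f \<Rightarrow> 'f \<Rightarrow> real" where
  "divergence S f g = S f g - S f f"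

definition affine_density ::
  "real^'n^'n \<Rightarrow> real^'n \<Rightarrow> (real^'n \<Rightarrow> real) \<Rightarrow> real^'n \<Rightarrow> real" where
  "affine_density \<sigma> \<mu> p = (\<lambda>\<omega>. \<bar>det \<sigma>\<bar> * p (\<sigma> *v \<omega> + \<mu>))"

(* The transformed densities need not lie in F; D is applied to them as a formula. *)
definition affine_invariant ::
  "(real^'n \<Rightarrow> real) set \<Rightarrow> ((real^'n \<Rightarrow> real) \<Rightarrow> (real^'n \<Rightarrow> real) \<Rightarrow> real)
     \<Rightarrow> (real^'n^'n \<Rightarrow> real^'n \<Rightarrow> real) \<Rightarrow> bool" where
  "affine_invariant F D h \<longleftrightarrow>
     (\<forall>\<sigma> \<mu>. invertible \<sigma> \<longrightarrow> h \<sigma> \<mu> > 0 \<and>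
        (\<forall>p\<in>F. \<forall>q\<in>F. prob_density lborel p \<longrightarrow> prob_density lborel q \<longrightarrow>
           h \<sigma> \<mu> * D (affine_density \<sigma> \<mu> p) (affine_density \<sigma> \<mu> q) = D p q))"

end

theory Submission
  imports Defs
begin

text \<open>
  Write \<open>T x = \<sigma> x + \<mu>\<close> and \<open>c = |det \<sigma>|\<close>, so that the transformed density is \<open>c (p \<circ> T)\<close>.
  The only analytic input is the change of variables \<open>c \<integral> f \<circ> T = \<integral> f\<close>.

  For \<open>\<gamma> > 0\<close> both \<open>\<integral> p q^\<gamma>\<close> and \<open>\<integral> q^(1 + \<gamma>)\<close> are homogeneous of degree \<open>1 + \<gamma>\<close> in the densities:
  transforming produces a factor \<open>c^(1 + \<gamma>)\<close>, of which the substitution absorbs one \<open>c\<close>. Hence the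
  quotient inside \<open>\<phi>\<close> does not change, and the score itself is multiplied by \<open>c^\<gamma>\<close>
  (\<open>holder_score_affine\<close>).

  For \<open>\<gamma> = 0\<close> the factor \<open>c\<close> inside the logarithm splits off as a summand, so the score of \<open>(p, q)\<close>
  changes by \<open>- ln c \<integral> p\<close> (\<open>KL_score_affine\<close>). This shift depends on \<open>p\<close> alone and therefore cancels
  in the divergence, which subtracts the score of \<open>(p, p)\<close>. The extended-real integral is first
  turned into a real one: integrability of \<open>p log q\<close> forces \<open>q > 0\<close> almost everywhere on \<open>p > 0\<close>.

  The change of variables itself (\<open>lborel_affine_matrix\<close>) is proved for an arbitrary finite index
  type, without an order on the coordinates. The claim that \<open>\<sigma>\<close> scales Lebesgue measure
  by \<open>c\<close> is stable under matrix products, so it suffices to treat diagonal matrices, transpositions of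
  two coordinates, and elementary shears.
\<close>

section \<open>Lebesgue measure under affine maps\<close>

lemma measurable_matrix_vector_mult:
  fixes A :: "real^'n^'n"
  shows "(*v) A \<in> borel_measurable borel"
  by (intro borel_measurable_continuous_onI linear_continuous_on matrix_vector_mul_bounded_linear)

lemma prod_Basis_cart:
  fixes f :: "real^'n \<Rightarrow> 'b::comm_monoid_mult"
  shows "(\<Prod>b\<in>Basis. f b) = (\<Prod>i\<in>UNIV. f (axis i 1))"
proof -
  have Basis: "(Basis :: (real^'n) set) = range (\<lambda>i. axis i 1)"
    by (auto simp: Basis_vec_def)
  have "prod f (range (\<lambda>i. axis i 1 :: real^'n)) = (\<Prod>i\<in>UNIV. f (axis i 1))"
    by (subst prod.reindex) (auto simp: inj_on_def axis_eq_axis)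
  then show ?thesis
    unfolding Basis .
qed

text \<open>
  The volume of a sheared box is known when the lower end of the coordinate that is added is
  nonnegative. Since a shear is linear, translating a box translates its image, so that any box can be
  moved to one whose lower end there is 0.
\<close>

lemma measure_shear_cbox:
  fixes a b :: "real^'n"
  assumes "m \<noteq> n"
  defines "T \<equiv> \<lambda>x::real^'n. \<chi> i. if i = m then x $ m + x $ n else x $ i"
  shows "measure lebesgue (T ` cbox a b) = measure lebesgue (cbox a b)"
proof (cases "cbox a b = {}")
  case False
  define v where "v = a $ n *\<^sub>R (axis n 1 :: real^'n)"
  have "T ` cbox a b = (+) (T v) ` T ` cbox (a - v) (b - v)"
  proof -
    have "T (v + x) = T v + T x" for x
      by (simp add: T_def vec_eq_iff)
    moreover have "cbox a b = (+) v ` cbox (a - v) (b - v)"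
      by (simp flip: cbox_translation)
    ultimately show ?thesis
      by (simp add: image_image)
  qed
  then have "measure lebesgue (T ` cbox a b) = measure lebesgue (T ` cbox (a - v) (b - v))"
    by (simp add: measure_translation)
  also have "\<dots> = measure lebesgue (cbox (a - v) (b - v))"
    unfolding T_def
  proof (rule measure_shear_interval[OF \<open>m \<noteq> n\<close>])
    show "cbox (a - v) (b - v) \<noteq> {}"
      using False by (simp add: box_ne_empty inner_diff_left)
    show "0 \<le> (a - v) $ n"
      by (simp add: v_def)
  qed
  also have "cbox (a - v) (b - v) = (+) (- v) ` cbox a b"
    using cbox_translation[of "- v" a b] by simp
  also have "measure lebesgue \<dots> = measure lebesgue (cbox a b)"
    by (rule measure_translation)
  finally show ?thesis .
qed simp

text \<open>
  Volumes of images under the shear \<open>T\<close> are volumes of preimages under its inverse \<open>S\<close>. Thus \<open>S\<close>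
  preserves the measure of boxes and hence Lebesgue measure, and then so does its inverse \<open>T\<close>.
\<close>

lemma emeasure_lborel_vimage_shear:
  fixes X :: "(real^'n) set"
  assumes "m \<noteq> n" and X: "X \<in> sets borel"
  shows "emeasure lborel ((\<lambda>x. \<chi> i. if i = m then x $ m + x $ n else x $ i) -` X) =
    emeasure lborel X"
proof -
  define T where "T x = (\<chi> i. if i = m then x $ m + x $ n else x $ i)" for x :: "real^'n"
  define S where "S x = (\<chi> i. if i = m then x $ m - x $ n else x $ i)" for x :: "real^'n"
  have TS: "T (S x) = x" and ST: "S (T x) = x" for x
    using \<open>m \<noteq> n\<close> by (simp_all add: T_def S_def vec_eq_iff)
  have "linear T" "linear S"
    by (auto intro!: linearI simp: T_def S_def vec_eq_iff algebra_simps)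
  then have [measurable]: "T \<in> borel \<rightarrow>\<^sub>M borel" "S \<in> borel \<rightarrow>\<^sub>M borel"
    by (auto intro!: borel_measurable_continuous_onI linear_continuous_on simp: linear_linear)
  have "lborel = distr lborel borel S"
  proof (rule lborel_eqI)
    fix l u :: "real^'n"
    assume le: "\<And>b. b \<in> Basis \<Longrightarrow> l \<bullet> b \<le> u \<bullet> b"
    have vimage: "S -` box l u = T ` box l u"
    proof
      show "S -` box l u \<subseteq> T ` box l u"
        by (metis TS image_eqI subsetI vimageD)
      show "T ` box l u \<subseteq> S -` box l u"
        by (auto simp: ST)
    qed
    have *: "T ` box l u \<in> lmeasurable \<and>
        1 * measure lebesgue (box l u) = measure lebesgue (T ` box l u)"
      using \<open>linear T\<close> measure_shear_cbox[OF \<open>m \<noteq> n\<close>]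
      by (intro measure_linear_sufficient) (auto simp: T_def[abs_def])
    have [measurable]: "T ` box l u \<in> sets borel"
      by (metis vimage \<open>S \<in> borel \<rightarrow>\<^sub>M borel\<close> box_borel measurable_sets_borel)
    have "emeasure (distr lborel borel S) (box l u) = emeasure lebesgue (T ` box l u)"
      by (simp add: emeasure_distr vimage)
    also have "\<dots> = emeasure lebesgue (box l u)"
      using * by (simp add: emeasure_eq_measure2 lmeasurable_open)
    finally show "emeasure (distr lborel borel S) (box l u) = (\<Prod>b\<in>Basis. (u - l) \<bullet> b)"
      using le by simp
  qed simp
  then have "emeasure lborel (T -` X) = emeasure (distr lborel borel S) (T -` X)"
    by simp
  also have "\<dots> = emeasure lborel X"
    using X by (simp add: emeasure_distr measurable_sets_borel[of T borel] vimage_def TS)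
  finally show ?thesis
    by (simp add: T_def[abs_def])
qed

lemma emeasure_lborel_vimage_transpose:
  fixes X :: "(real^'n) set"
  assumes X: "X \<in> sets borel"
  shows "emeasure lborel ((\<lambda>x. \<chi> i. x $ Transposition.transpose m n i) -` X) = emeasure lborel X"
proof -
  define T where "T x = (\<chi> i. x $ Transposition.transpose m n i)" for x :: "real^'n"
  have "linear T"
    by (auto intro!: linearI simp: T_def vec_eq_iff)
  then have [measurable]: "T \<in> borel \<rightarrow>\<^sub>M borel"
    by (auto intro!: borel_measurable_continuous_onI linear_continuous_on simp: linear_linear)
  have "lborel = distr lborel borel T"
  proof (rule lborel_eqI)
    fix l u :: "real^'n"
    assume "\<And>b. b \<in> Basis \<Longrightarrow> l \<bullet> b \<le> u \<bullet> b"
    then have le: "l $ i \<le> u $ i" for i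
      by (metis axis_in_Basis_iff Basis_real_def cart_eq_inner_axis insertI1)
    have "T -` box l u = box (T l) (T u)"
      by (auto simp: T_def mem_box_cart) (metis transpose_involutory)+
    moreover have "(\<Prod>i\<in>UNIV. (T u - T l) $ i) = (\<Prod>i\<in>UNIV. (u - l) $ i)"
      using prod.permute[OF permutes_swap_id[of m UNIV n], of "\<lambda>i. (u - l) $ i"]
      by (simp add: T_def o_def)
    moreover have "\<And>b. b \<in> Basis \<Longrightarrow> T l \<bullet> b \<le> T u \<bullet> b"
      using le by (auto simp: T_def Basis_vec_def inner_axis)
    ultimately show "emeasure (distr lborel borel T) (box l u) = (\<Prod>b\<in>Basis. (u - l) \<bullet> b)"
      by (simp add: emeasure_distr prod_Basis_cart inner_axis)
  qed simp
  then have "emeasure lborel X = emeasure (distr lborel borel T) X"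
    by simp
  also have "\<dots> = emeasure lborel (T -` X)"
    using X by (simp add: emeasure_distr)
  finally show ?thesis
    by (simp add: T_def[abs_def])
qed

lemma emeasure_lborel_vimage_diagonal:
  fixes A :: "real^'n^'n"
  assumes diag: "\<And>i j. i \<noteq> j \<Longrightarrow> A $ i $ j = 0" and "det A \<noteq> 0" and X: "X \<in> sets borel"
  shows "ennreal \<bar>det A\<bar> * emeasure lborel ((*v) A -` X) = emeasure lborel X"
proof -
  define c where "c j = (A *v j) \<bullet> j" for j :: "real^'n"
  have Basis: "(Basis :: (real^'n) set) = range (\<lambda>i. axis i 1)"
    by (auto simp: Basis_vec_def)
  have c: "c (axis i 1) = A $ i $ i" for i
    by (simp add: c_def inner_axis matrix_vector_mult_basis column_def)
  have det: "det A = (\<Prod>i\<in>UNIV. A $ i $ i)"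
    using diag by (rule det_diagonal)
  have T: "(*v) A = (\<lambda>x. 0 + (\<Sum>j\<in>Basis. (c j * (x \<bullet> j)) *\<^sub>R j))"
  proof (rule ext, rule euclidean_eqI)
    fix x b :: "real^'n" assume b: "b \<in> Basis"
    then obtain i where i: "b = axis i 1"
      by (auto simp: Basis)
    have "(A *v x) \<bullet> b = (\<Sum>j\<in>UNIV. A $ i $ j * x $ j)"
      by (simp add: i inner_axis matrix_vector_mult_def)
    also have "\<dots> = (\<Sum>j\<in>UNIV. if j = i then A $ i $ i * x $ i else 0)"
      using diag by (intro sum.cong) auto
    also have "\<dots> = c b * (x \<bullet> b)"
      by (simp add: i c inner_axis)
    finally show "(A *v x) \<bullet> b = (0 + (\<Sum>j\<in>Basis. (c j * (x \<bullet> j)) *\<^sub>R j)) \<bullet> b"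
      using b by (simp add: inner_sum_left_Basis)
  qed
  have "c j \<noteq> 0" if j: "j \<in> Basis" for j
  proof -
    obtain i where "j = axis i 1"
      using j by (auto simp: Basis)
    with \<open>det A \<noteq> 0\<close> show ?thesis
      by (simp add: c det)
  qed
  moreover have "(\<Prod>j\<in>Basis. \<bar>c j\<bar>) = \<bar>det A\<bar>"
    by (simp add: det abs_prod prod_Basis_cart c)
  ultimately have "lborel = density (distr lborel borel ((*v) A)) (\<lambda>_. \<bar>det A\<bar>)"
    using lborel_affine_euclidean[of c 0] unfolding T by simp
  then have "emeasure lborel X = emeasure (density (distr lborel borel ((*v) A)) (\<lambda>_. \<bar>det A\<bar>)) X"
    by simp
  also have "\<dots> = ennreal \<bar>det A\<bar> * emeasure lborel ((*v) A -` X)"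
    using X by (simp add: emeasure_density_const emeasure_distr measurable_matrix_vector_mult)
  finally show ?thesis ..
qed

text \<open>
  The induction over elementary matrices also passes through singular matrices (those with a zero
  row), which collapse volume. The assumption that the determinant is nonzero is therefore carried
  inside the induction predicate; it is inherited by the factors of a product.
\<close>

lemma emeasure_lborel_vimage_matrix:
  fixes A :: "real^'n^'n"
  assumes "det A \<noteq> 0" and "X \<in> sets borel"
  shows "ennreal \<bar>det A\<bar> * emeasure lborel ((*v) A -` X) = emeasure lborel X"
proof -
  have "det A \<noteq> 0 \<longrightarrow> (\<forall>X\<in>sets borel.
      ennreal \<bar>det A\<bar> * emeasure lborel ((*v) A -` X) = emeasure lborel X)"
  proof (induction A rule: induct_matrix_elementary_alt)
    case (1 A B)
    show ?case
    proof (intro impI ballI)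
      fix X :: "(real^'n) set"
      assume "det (A ** B) \<noteq> 0" and X: "X \<in> sets borel"
      then have "det A \<noteq> 0" "det B \<noteq> 0"
        by (auto simp: det_mul)
      have "(*v) A -` X \<in> sets borel"
        using measurable_sets_borel[OF measurable_matrix_vector_mult X] .
      then have "emeasure lborel X =
          ennreal \<bar>det A\<bar> * (ennreal \<bar>det B\<bar> * emeasure lborel ((*v) B -` (*v) A -` X))"
        using 1 \<open>det A \<noteq> 0\<close> \<open>det B \<noteq> 0\<close> X by simp
      also have "(*v) B -` (*v) A -` X = (*v) (A ** B) -` X"
        by (simp add: vimage_def matrix_vector_mul_assoc)
      finally show "ennreal \<bar>det (A ** B)\<bar> * emeasure lborel ((*v) (A ** B) -` X) = emeasure lborel X"
        by (simp add: det_mul abs_mult ennreal_mult mult.assoc)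
    qed
  next
    case (2 A i)
    then show ?case
      by (simp add: det_zero_row)
  next
    case (3 A)
    then show ?case
      using emeasure_lborel_vimage_diagonal by blast
  next
    case (4 m n)
    let ?P = "\<chi> i j. mat 1 $ i $ Transposition.transpose m n j :: real^'n^'n"
    have "\<bar>det ?P\<bar> = 1"
      by (simp add: det_permute_columns permutes_swap_id sign_swap_id abs_mult)
    moreover have "(*v) ?P = (\<lambda>x. \<chi> i. x $ Transposition.transpose m n i)"
    proof
      fix x :: "real^'n"
      have "(?P *v x) $ i = x $ Transposition.transpose m n i" for i
      proof -
        have "(?P *v x) $ i = (\<Sum>j\<in>UNIV. if j = Transposition.transpose m n i then x $ j else 0)"
        proof -
          have "i = Transposition.transpose m n j \<longleftrightarrow> j = Transposition.transpose m n i" for j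
            by auto
          then show ?thesis
            by (simp add: matrix_vector_mult_def mat_def if_distrib[of "\<lambda>t. t * _"] cong: if_cong)
        qed
        then show ?thesis
          by simp
      qed
      then show "?P *v x = (\<chi> i. x $ Transposition.transpose m n i)"
        by (simp add: vec_eq_iff)
    qed
    ultimately show ?case
      by (simp add: emeasure_lborel_vimage_transpose)
  next
    case (5 m n)
    let ?E = "\<chi> i j. of_bool (i = m \<and> j = n \<or> i = j) :: real^'n^'n"
    have "?E = (\<chi> k. if k = m then row m (mat 1) + 1 *s row n (mat 1) else row k (mat 1))"
      using 5 by (auto simp: vec_eq_iff row_def mat_def)
    then have "det ?E = 1"
      using det_row_operation[OF 5, of "mat 1 :: real^'n^'n" 1] by simp
    moreover have "(*v) ?E = (\<lambda>x. \<chi> i. if i = m then x $ m + x $ n else x $ i)"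
    proof
      fix x :: "real^'n"
      have "(?E *v x) $ i = (if i = m then x $ m + x $ n else x $ i)" for i
      proof -
        have "(?E *v x) $ i =
            (\<Sum>j\<in>UNIV. (if j = i then x $ j else 0) + (if j = n then if i = m then x $ j else 0 else 0))"
          unfolding matrix_vector_mult_def using 5
          by (auto intro!: sum.cong)
        then show ?thesis
          by (simp add: sum.distrib)
      qed
      then show "?E *v x = (\<chi> i. if i = m then x $ m + x $ n else x $ i)"
        by (simp add: vec_eq_iff)
    qed
    ultimately show ?case
      using 5 by (simp add: emeasure_lborel_vimage_shear)
  qed
  with assms show ?thesis
    by blast
qed

lemma measurable_affine:
  fixes \<sigma> :: "real^'n^'n"
  shows "(\<lambda>x. \<sigma> *v x + \<mu>) \<in> borel \<rightarrow>\<^sub>M borel"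
  using measurable_matrix_vector_mult[of \<sigma>] by measurable

theorem lborel_affine_matrix:
  fixes \<sigma> :: "real^'n^'n"
  assumes "invertible \<sigma>"
  shows "lborel = density (distr lborel borel (\<lambda>x. \<sigma> *v x + \<mu>)) (\<lambda>_. \<bar>det \<sigma>\<bar>)"
proof (rule measure_eqI)
  fix X :: "(real^'n) set" assume "X \<in> sets lborel"
  then have X: "X \<in> sets borel" by simp
  have [simp]: "det \<sigma> \<noteq> 0"
    using assms by (simp add: invertible_det_nz)
  have Y: "(+) \<mu> -` X \<in> sets borel"
    using X by (intro measurable_sets_borel[OF _ X]) simp
  have "emeasure lborel X = emeasure (distr lborel borel ((+) \<mu>)) X"
    by (simp add: lborel_distr_plus)
  also have "\<dots> = emeasure lborel ((+) \<mu> -` X)"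
    using X by (simp add: emeasure_distr)
  also have "\<dots> = \<bar>det \<sigma>\<bar> * emeasure lborel ((*v) \<sigma> -` (+) \<mu> -` X)"
    using emeasure_lborel_vimage_matrix[of \<sigma>, OF _ Y] by simp
  also have "(*v) \<sigma> -` (+) \<mu> -` X = (\<lambda>x. \<sigma> *v x + \<mu>) -` X"
    by (auto simp: add.commute)
  also have "\<bar>det \<sigma>\<bar> * emeasure lborel \<dots> =
      emeasure (density (distr lborel borel (\<lambda>x. \<sigma> *v x + \<mu>)) (\<lambda>_. \<bar>det \<sigma>\<bar>)) X"
    using X by (simp add: emeasure_density_const emeasure_distr measurable_affine)
  finally show "emeasure lborel X =
      emeasure (density (distr lborel borel (\<lambda>x. \<sigma> *v x + \<mu>)) (\<lambda>_. \<bar>det \<sigma>\<bar>)) X" .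
qed simp


lemma
  fixes \<sigma> :: "real^'n^'n" and f :: "real^'n \<Rightarrow> real"
  assumes "invertible \<sigma>" and [measurable]: "f \<in> borel_measurable borel"
  shows integrable_affine_matrix_iff:
      "integrable lborel (\<lambda>x. f (\<sigma> *v x + \<mu>)) \<longleftrightarrow> integrable lborel f"
    and integral_affine_matrix:
      "\<bar>det \<sigma>\<bar> * (\<integral>x. f (\<sigma> *v x + \<mu>) \<partial>lborel) = (\<integral>x. f x \<partial>lborel)"
proof -
  note [measurable] = measurable_affine
  have "det \<sigma> \<noteq> 0"
    using assms by (simp add: invertible_det_nz)
  then show "integrable lborel (\<lambda>x. f (\<sigma> *v x + \<mu>)) \<longleftrightarrow> integrable lborel f"
    by (subst (2) lborel_affine_matrix[OF assms(1), of \<mu>])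
      (simp add: integrable_density integrable_distr_eq)
  show "\<bar>det \<sigma>\<bar> * (\<integral>x. f (\<sigma> *v x + \<mu>) \<partial>lborel) = (\<integral>x. f x \<partial>lborel)"
    by (subst (2) lborel_affine_matrix[OF assms(1), of \<mu>])
      (simp add: integral_density integral_distr)
qed

lemma AE_affine_matrix:
  fixes \<sigma> :: "real^'n^'n"
  assumes "invertible \<sigma>" and [measurable]: "Measurable.pred borel P"
    and AE: "AE x in lborel. P x"
  shows "AE x in lborel. P (\<sigma> *v x + \<mu>)"
proof -
  note [measurable] = measurable_affine
  have "det \<sigma> \<noteq> 0"
    using assms by (simp add: invertible_det_nz)
  then show ?thesis
    using AE by (subst (asm) lborel_affine_matrix[OF assms(1), of \<mu>])
      (simp add: AE_density AE_distr_iff)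
qed

section \<open>The score for positive parameter\<close>

lemma holder_score_affine:
  fixes \<sigma> :: "real^'n^'n"
  assumes "invertible \<sigma>" "\<gamma> > 0"
    and [measurable]: "p \<in> borel_measurable borel" "q \<in> borel_measurable borel"
    and "\<And>x. 0 \<le> q x"
  shows "holder_score lborel \<gamma> \<phi> (affine_density \<sigma> \<mu> p) (affine_density \<sigma> \<mu> q) =
    \<bar>det \<sigma>\<bar> powr \<gamma> * holder_score lborel \<gamma> \<phi> p q"
proof -
  define c where "c = \<bar>det \<sigma>\<bar>"
  have "c > 0"
    using assms by (simp add: c_def invertible_det_nz)
  \<comment> \<open>of the factor \<open>c^(1 + \<gamma>)\<close>, one \<open>c\<close> is the Jacobian\<close>
  have subst: "(\<integral>x. c powr \<gamma> * (c * f (\<sigma> *v x + \<mu>)) \<partial>lborel) = c powr \<gamma> * (\<integral>x. f x \<partial>lborel)"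
    if "f \<in> borel_measurable borel" for f
    using integral_affine_matrix[OF assms(1) that, of \<mu>] by (simp add: c_def)
  have "(\<integral>x. affine_density \<sigma> \<mu> p x * affine_density \<sigma> \<mu> q x powr \<gamma> \<partial>lborel) =
      (\<integral>x. c powr \<gamma> * (c * (p (\<sigma> *v x + \<mu>) * q (\<sigma> *v x + \<mu>) powr \<gamma>)) \<partial>lborel)"
    using \<open>c > 0\<close> assms(5) by (simp add: affine_density_def powr_mult ac_simps flip: c_def)
  then have cross: "(\<integral>x. affine_density \<sigma> \<mu> p x * affine_density \<sigma> \<mu> q x powr \<gamma> \<partial>lborel) =
      c powr \<gamma> * (\<integral>x. p x * q x powr \<gamma> \<partial>lborel)"
    using subst[of "\<lambda>x. p x * q x powr \<gamma>"] by simp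
  have "(\<integral>x. affine_density \<sigma> \<mu> q x powr (1 + \<gamma>) \<partial>lborel) =
      (\<integral>x. c powr \<gamma> * (c * q (\<sigma> *v x + \<mu>) powr (1 + \<gamma>)) \<partial>lborel)"
    using \<open>c > 0\<close> assms(5) by (simp add: affine_density_def powr_mult powr_add ac_simps flip: c_def)
  then have norm: "(\<integral>x. affine_density \<sigma> \<mu> q x powr (1 + \<gamma>) \<partial>lborel) =
      c powr \<gamma> * (\<integral>x. q x powr (1 + \<gamma>) \<partial>lborel)"
    using subst[of "\<lambda>x. q x powr (1 + \<gamma>)"] by simp
  show ?thesis
    using \<open>c > 0\<close> unfolding holder_score_def cross norm by (simp flip: c_def)
qed

section \<open>The logarithmic score\<close>

lemma ext_integral_eq_integral:
  assumes "integrable M v" and "AE x in M. u x = ereal (v x)"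
  shows "ext_integral M u = (\<integral>x. v x \<partial>M)"
proof -
  have "(\<integral>\<^sup>+x. e2ennreal (u x) \<partial>M) = (\<integral>\<^sup>+x. ennreal (v x) \<partial>M)"
    using assms(2) by (intro nn_integral_cong_AE) auto
  moreover have "(\<integral>\<^sup>+x. e2ennreal (- u x) \<partial>M) = (\<integral>\<^sup>+x. ennreal (- v x) \<partial>M)"
    using assms(2) by (intro nn_integral_cong_AE) auto
  ultimately show ?thesis
    using assms(1) by (simp add: ext_integral_def real_lebesgue_integral_def)
qed

lemma AE_finite_of_ext_integrable:
  assumes "ext_integrable M u"
  shows "AE x in M. \<bar>u x\<bar> \<noteq> \<infinity>"
proof -
  have [measurable]: "u \<in> borel_measurable M"
    using assms by (simp add: ext_integrable_def)
  have "AE x in M. e2ennreal (u x) \<noteq> \<infinity>" "AE x in M. e2ennreal (- u x) \<noteq> \<infinity>"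
    using assms by (intro nn_integral_PInf_AE; simp add: ext_integrable_def less_top)+
  then show ?thesis
  proof eventually_elim
    case (elim x)
    then show ?case
      by (cases "u x") auto
  qed
qed

text \<open>
  A point with \<open>q x = 0 < p x\<close> gives the integrand the value \<open>- \<infinity>\<close>, so such points form a null set.
  Where \<open>p x = 0\<close> both products vanish, whatever the logarithm. Hence replacing the extended
  logarithm by the real one, which is 0 at 0, changes the integrand only on a null set.
\<close>

lemma ext_integrable_mult_ext_ln:
  assumes ext: "ext_integrable M (\<lambda>x. ereal (p x) * ext_ln (q x))"
    and [measurable]: "p \<in> borel_measurable M" "q \<in> borel_measurable M"
    and nonneg: "\<And>x. 0 \<le> p x" "\<And>x. 0 \<le> q x"
  shows "AE x in M. p x = 0 \<or> q x > 0"
    and "integrable M (\<lambda>x. p x * ln (q x))"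
proof -
  show AE: "AE x in M. p x = 0 \<or> q x > 0"
    using AE_finite_of_ext_integrable[OF ext]
  proof eventually_elim
    case (elim x)
    then show ?case
      using nonneg(1)[of x] by (cases "q x > 0") (auto simp: ext_ln_def split: if_splits)
  qed
  then have eq: "AE x in M. ereal (p x) * ext_ln (q x) = ereal (p x * ln (q x))"
    by eventually_elim (auto simp: ext_ln_def)
  then have "(\<integral>\<^sup>+x. ennreal (p x * ln (q x)) \<partial>M) = (\<integral>\<^sup>+x. e2ennreal (ereal (p x) * ext_ln (q x)) \<partial>M)"
    by (intro nn_integral_cong_AE, eventually_elim) (simp del: times_ereal.simps)
  moreover have "(\<integral>\<^sup>+x. ennreal (- (p x * ln (q x))) \<partial>M) =
      (\<integral>\<^sup>+x. e2ennreal (- (ereal (p x) * ext_ln (q x))) \<partial>M)"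
    using eq by (intro nn_integral_cong_AE, eventually_elim) simp
  ultimately show "integrable M (\<lambda>x. p x * ln (q x))"
    using ext by (simp add: real_integrable_def ext_integrable_def less_top[symmetric])
qed

lemma KL_score_eq_integral:
  assumes "AE x in M. p x = 0 \<or> q x > 0"
    and "integrable M (\<lambda>x. p x * ln (q x))" and "integrable M q"
  shows "KL_score M p q = (\<integral>x. q x \<partial>M) - (\<integral>x. p x * ln (q x) \<partial>M)"
proof -
  have "AE x in M. - (ereal (p x) * ext_ln (q x)) + ereal (q x) = ereal (q x - p x * ln (q x))"
    using assms(1) by eventually_elim (auto simp: ext_ln_def)
  then have "KL_score M p q = (\<integral>x. q x - p x * ln (q x) \<partial>M)"
    unfolding KL_score_def using assms(2,3) by (intro ext_integral_eq_integral) auto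
  then show ?thesis
    using assms(2,3) by simp
qed

text \<open>
  Pointwise, \<open>c p ln (c q) = c (p ln q + ln c p)\<close> wherever \<open>p = 0\<close> or \<open>q > 0\<close>. Substitution absorbs the
  outer \<open>c\<close>, and the second summand is the shift.
\<close>

lemma KL_score_affine:
  fixes \<sigma> :: "real^'n^'n"
  assumes \<sigma>: "invertible \<sigma>"
    and [measurable]: "p \<in> borel_measurable borel" "q \<in> borel_measurable borel"
    and int: "integrable lborel p" "integrable lborel q"
    and nonneg: "\<And>x. 0 \<le> p x" "\<And>x. 0 \<le> q x"
    and ext: "ext_integrable lborel (\<lambda>x. ereal (p x) * ext_ln (q x))"
  shows "KL_score lborel (affine_density \<sigma> \<mu> p) (affine_density \<sigma> \<mu> q) =
    KL_score lborel p q - ln \<bar>det \<sigma>\<bar> * (\<integral>x. p x \<partial>lborel)"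
proof -
  define c where "c = \<bar>det \<sigma>\<bar>"
  have "c > 0"
    using \<sigma> by (simp add: c_def invertible_det_nz)
  let ?T = "\<lambda>x. \<sigma> *v x + \<mu>"
  define f where "f x = p x * ln (q x) + ln c * p x" for x
  have [measurable]: "f \<in> borel_measurable borel"
    unfolding f_def by measurable
  have pq: "AE x in lborel. p x = 0 \<or> q x > 0" "integrable lborel (\<lambda>x. p x * ln (q x))"
    using ext_integrable_mult_ext_ln[OF ext _ _ nonneg] by simp_all
  then have f: "integrable lborel f"
    using int by (simp add: f_def[abs_def])
  have AE: "AE x in lborel. p (?T x) = 0 \<or> q (?T x) > 0"
    using pq(1) by (intro AE_affine_matrix[OF \<sigma>]) simp
  then have log: "AE x in lborel.
      affine_density \<sigma> \<mu> p x * ln (affine_density \<sigma> \<mu> q x) = c * f (?T x)"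
  proof eventually_elim
    case (elim x)
    then show ?case
      using \<open>c > 0\<close> by (auto simp: affine_density_def f_def ln_mult algebra_simps simp flip: c_def)
  qed
  note [measurable] = measurable_affine
  have [measurable]: "affine_density \<sigma> \<mu> p \<in> borel_measurable borel"
    "affine_density \<sigma> \<mu> q \<in> borel_measurable borel"
    unfolding affine_density_def by measurable
  have "KL_score lborel (affine_density \<sigma> \<mu> p) (affine_density \<sigma> \<mu> q) =
      (\<integral>x. affine_density \<sigma> \<mu> q x \<partial>lborel) -
      (\<integral>x. affine_density \<sigma> \<mu> p x * ln (affine_density \<sigma> \<mu> q x) \<partial>lborel)"
  proof (rule KL_score_eq_integral)
    show "AE x in lborel. affine_density \<sigma> \<mu> p x = 0 \<or> affine_density \<sigma> \<mu> q x > 0"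
      using AE
    proof eventually_elim
      case (elim x)
      then show ?case
        using \<open>c > 0\<close> by (auto simp: affine_density_def simp flip: c_def)
    qed
    have "integrable lborel (\<lambda>x. c * f (?T x))"
      using f by (simp add: integrable_affine_matrix_iff[OF \<sigma>])
    then show "integrable lborel (\<lambda>x. affine_density \<sigma> \<mu> p x * ln (affine_density \<sigma> \<mu> q x))"
      by (subst integrable_cong_AE[OF _ _ log]) simp_all
    show "integrable lborel (affine_density \<sigma> \<mu> q)"
      unfolding affine_density_def using int(2) by (simp add: integrable_affine_matrix_iff[OF \<sigma>])
  qed
  also have "(\<integral>x. affine_density \<sigma> \<mu> q x \<partial>lborel) = (\<integral>x. q x \<partial>lborel)"
    by (simp add: affine_density_def integral_affine_matrix[OF \<sigma>])
  also have "(\<integral>x. affine_density \<sigma> \<mu> p x * ln (affine_density \<sigma> \<mu> q x) \<partial>lborel) =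
      (\<integral>x. c * f (?T x) \<partial>lborel)"
    using log by (intro integral_cong_AE) simp_all
  also have "\<dots> = (\<integral>x. f x \<partial>lborel)"
    using integral_affine_matrix[OF \<sigma>, of f \<mu>] by (simp add: c_def)
  also have "\<dots> = (\<integral>x. p x * ln (q x) \<partial>lborel) + ln c * (\<integral>x. p x \<partial>lborel)"
    using pq int by (simp add: f_def)
  finally show ?thesis
    using KL_score_eq_integral[OF pq int(2)] by (simp add: c_def)
qed

section \<open>Affine invariance of the divergences\<close>

lemma L_plus_lborelD:
  assumes "f \<in> L_plus lborel \<alpha>"
  shows "f \<in> borel_measurable borel" and "0 \<le> f x"
  using assms by (auto simp: L_plus_def)

lemma integrable_of_L_plus_1:
  assumes "f \<in> L_plus lborel 1"
  shows "integrable lborel f"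
proof -
  have "f x powr 1 = f x" for x
    using L_plus_lborelD(2)[OF assms, of x] by simp
  with assms show ?thesis
    by (simp add: L_plus_def del: powr_one powr_one')
qed

lemma holder_divergence_affine:
  fixes \<sigma> :: "real^'n^'n"
  assumes "invertible \<sigma>" "\<gamma> > 0" "p \<in> L_plus lborel \<alpha>" "q \<in> L_plus lborel \<alpha>"
  shows "divergence (holder_score lborel \<gamma> \<phi>) (affine_density \<sigma> \<mu> p) (affine_density \<sigma> \<mu> q) =
    \<bar>det \<sigma>\<bar> powr \<gamma> * divergence (holder_score lborel \<gamma> \<phi>) p q"
  using assms by (simp add: divergence_def holder_score_affine L_plus_lborelD right_diff_distrib)

lemma KL_divergence_affine:
  fixes \<sigma> :: "real^'n^'n"
  assumes "invertible \<sigma>" and F: "KL_domain lborel F" and pq: "p \<in> F" "q \<in> F"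
  shows "divergence (KL_score lborel) (affine_density \<sigma> \<mu> p) (affine_density \<sigma> \<mu> q) =
    divergence (KL_score lborel) p q"
proof -
  have shift: "KL_score lborel (affine_density \<sigma> \<mu> p) (affine_density \<sigma> \<mu> g) =
      KL_score lborel p g - ln \<bar>det \<sigma>\<bar> * (\<integral>x. p x \<partial>lborel)" if "g \<in> F" for g
  proof -
    have "p \<in> L_plus lborel 1" "g \<in> L_plus lborel 1"
      and "ext_integrable lborel (\<lambda>x. ereal (p x) * ext_ln (g x))"
      using F pq that by (auto simp: KL_domain_def)
    with \<open>invertible \<sigma>\<close> show ?thesis
      by (intro KL_score_affine L_plus_lborelD integrable_of_L_plus_1)
  qed
  show ?thesis
    using pq by (simp add: divergence_def shift)
qed

theorem mainTheorem6:
  shows "(\<forall>\<gamma> \<phi>. \<gamma> > 0 \<longrightarrow> holder_function \<gamma> \<phi> \<longrightarrow>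
            (\<forall>(\<sigma> :: real^'n^'n) \<mu>. invertible \<sigma> \<longrightarrow>
               (\<forall>p\<in>L_plus lborel (1 + \<gamma>). \<forall>q\<in>L_plus lborel (1 + \<gamma>).
                  prob_density lborel p \<longrightarrow> prob_density lborel q \<longrightarrow>
                  divergence (holder_score lborel \<gamma> \<phi>) (affine_density \<sigma> \<mu> p) (affine_density \<sigma> \<mu> q) =
                  \<bar>det \<sigma>\<bar> powr \<gamma> * divergence (holder_score lborel \<gamma> \<phi>) p q)) \<and>
            affine_invariant (L_plus (lborel :: (real^'n) measure) (1 + \<gamma>))
              (divergence (holder_score lborel \<gamma> \<phi>)) (\<lambda>\<sigma> \<mu>. \<bar>det \<sigma>\<bar> powr (- \<gamma>)))
       \<and> (\<forall>F. KL_domain lborel F \<longrightarrow>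
            (\<forall>(\<sigma> :: real^'n^'n) \<mu>. invertible \<sigma> \<longrightarrow>
               (\<forall>p\<in>F. \<forall>q\<in>F.
                  prob_density lborel p \<longrightarrow> prob_density lborel q \<longrightarrow>
                  divergence (KL_score lborel) (affine_density \<sigma> \<mu> p) (affine_density \<sigma> \<mu> q) =
                  divergence (KL_score lborel) p q)) \<and>
            affine_invariant F (divergence (KL_score lborel)) (\<lambda>\<sigma> \<mu>. 1))"
proof (intro conjI allI impI ballI)
  fix \<gamma> :: real and \<phi>
  assume \<gamma>: "\<gamma> > 0"
  show "affine_invariant (L_plus (lborel :: (real^'n) measure) (1 + \<gamma>))
      (divergence (holder_score lborel \<gamma> \<phi>)) (\<lambda>\<sigma> \<mu>. \<bar>det \<sigma>\<bar> powr (- \<gamma>))"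
    unfolding affine_invariant_def
    by (auto simp: invertible_det_nz holder_divergence_affine[OF _ \<gamma>] powr_minus)
qed (auto simp: holder_divergence_affine affine_invariant_def KL_divergence_affine)

end
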